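(* Let $n\ge1$ and let $\nu,\mu\in\mathbb{R}$ with $\mu>0$. For every $g\in U(n)\ltimes\mathbb{C}^n$, the operators $\Delta_{\nu,\mu}$ and $T^{\nu,\mu}_g$ acting on complex-valued $\mathcal{C}^\infty$ functions on $\mathbb{C}^n$ satisfy $$\Delta_{\nu,\mu}T^{\nu,\mu}_g=T^{\nu,\mu}_g\Delta_{\nu,\mu}.$$
   Context: $\langle z,w\rangle=\sum_{j=1}^n z_j\overline{w_j}$. The operator $\Delta_{\nu,\mu}$ on $\mathbb{C}^n=\mathbb{R}^{2n}$ is $$\Delta_{\nu,\mu}=4\sum_{j=1}^n\frac{\partial^2}{\partial z_j\partial\bar z_j}+2i\nu(E+\overline{E}+n)+2\mu(E-\overline{E})-(\nu^2+\mu^2)|z|^2,$$ with $E=\sum_{j=1}^n z_j\frac{\partial}{\partial z_j}$ and $\overline{E}=\sum_{j=1}^n\bar z_j\frac{\partial}{\partial\bar z_j}$. The group $U(n)\ltimes\mathbb{C}^n$ consists of pairs $g=[A,b]$ with $A\in U(n)$, $b\in\mathbb{C}^n$ (identified with the block matrices $\begin{pmatrix}A&b\\0&1\end{pmatrix}$), acting on $\mathbb{C}^n$ by $g.z=Az+b$, so $g^{-1}.0=-A^*b$. For $f\in\mathcal{C}^\infty(\mathbb{C}^n)$, $$[T^{\nu,\mu}_gf](z)=j^{\nu,\mu}(g,z)\,f(g.z),\qquad j^{\nu,\mu}(g,z)=\exp\Big(i\big(-\nu\,\mathrm{Re}\,\langle z,g^{-1}.0\rangle+\mu\,\mathrm{Im}\,\langle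 z,g^{-1}.0\rangle\big)\Big).$$ *)

theory Defs
  imports "HOL-Analysis.Analysis" "HOL-Algebra.Group"
begin

text \<open>The space of complex n-vectors is \<^typ>\<open>complex ^ 'n\<close> with \<open>n = CARD('n)\<close>. Its norm is the
  Euclidean one, and it is regarded as a real normed space, so that derivatives, including those
  in the definition of smoothness, are real derivatives.\<close>

definition herm :: "complex ^ 'n \<Rightarrow> complex ^ 'n \<Rightarrow> complex" where
  "herm z w = (\<Sum>j\<in>UNIV. z $ j * cnj (w $ j))"


subsection \<open>Smooth functions\<close>

fun Ck :: "nat \<Rightarrow> ('a::real_normed_vector \<Rightarrow> 'b::real_normed_vector) \<Rightarrow> bool" where
  "Ck 0 f \<longleftrightarrow> continuous_on UNIV f"
| "Ck (Suc k) f \<longleftrightarrow>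
     (\<forall>x. f differentiable (at x)) \<and> (\<forall>v. Ck k (\<lambda>x. frechet_derivative f (at x) v))"

definition smooth :: "('a::real_normed_vector \<Rightarrow> 'b::real_normed_vector) \<Rightarrow> bool" where
  "smooth f \<longleftrightarrow> (\<forall>k. Ck k f)"


subsection \<open>Wirtinger derivatives and the magnetic Laplacian\<close>

definition dir_deriv :: "complex ^ 'n \<Rightarrow> (complex ^ 'n \<Rightarrow> complex) \<Rightarrow> complex ^ 'n \<Rightarrow> complex" where
  "dir_deriv v f z = vector_derivative (\<lambda>t::real. f (z + t *\<^sub>R v)) (at 0)"

text \<open>With \<open>z\<^sub>j = x\<^sub>j + i y\<^sub>j\<close>, the directions \<open>axis j 1\<close> and \<open>axis j \<i>\<close> are those of \<open>x\<^sub>j\<close> and \<open>y\<^sub>j\<close>.\<close>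

definition dz :: "'n \<Rightarrow> (complex ^ 'n \<Rightarrow> complex) \<Rightarrow> complex ^ 'n \<Rightarrow> complex" where
  "dz j f z = (dir_deriv (axis j 1) f z - \<i> * dir_deriv (axis j \<i>) f z) / 2"

definition dzbar :: "'n \<Rightarrow> (complex ^ 'n \<Rightarrow> complex) \<Rightarrow> complex ^ 'n \<Rightarrow> complex" where
  "dzbar j f z = (dir_deriv (axis j 1) f z + \<i> * dir_deriv (axis j \<i>) f z) / 2"

definition euler :: "(complex ^ 'n \<Rightarrow> complex) \<Rightarrow> complex ^ 'n \<Rightarrow> complex" where
  "euler f z = (\<Sum>j\<in>UNIV. z $ j * dz j f z)"

definition euler_bar :: "(complex ^ 'n \<Rightarrow> complex) \<Rightarrow> complex ^ 'n \<Rightarrow> complex" where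
  "euler_bar f z = (\<Sum>j\<in>UNIV. cnj (z $ j) * dzbar j f z)"

definition mag_laplacian ::
    "real \<Rightarrow> real \<Rightarrow> (complex ^ 'n \<Rightarrow> complex) \<Rightarrow> complex ^ 'n \<Rightarrow> complex" where
  "mag_laplacian \<nu> \<mu> f z =
     4 * (\<Sum>j\<in>UNIV. dz j (dzbar j f) z)
     + 2 * \<i> * of_real \<nu> * (euler f z + euler_bar f z + of_nat CARD('n) * f z)
     + 2 * of_real \<mu> * (euler f z - euler_bar f z)
     - of_real ((\<nu>\<^sup>2 + \<mu>\<^sup>2) * (norm z)\<^sup>2) * f z"


subsection \<open>The motion group and its action on functions\<close>

definition adjoint_matrix :: "complex ^ 'n ^ 'm \<Rightarrow> complex ^ 'm ^ 'n" where
  "adjoint_matrix A = (\<chi> i j. cnj (A $ j $ i))"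

definition unitary_matrix :: "complex ^ 'n ^ 'n \<Rightarrow> bool" where
  "unitary_matrix A \<longleftrightarrow> adjoint_matrix A ** A = mat 1 \<and> A ** adjoint_matrix A = mat 1"

text \<open>A pair \<open>(A, b)\<close> stands for the block matrix with rows \<open>(A b)\<close> and \<open>(0 1)\<close>; the
  multiplication is that of block matrices.\<close>

definition motion_group :: "((complex ^ 'n ^ 'n) \<times> (complex ^ 'n)) monoid" where
  "motion_group =
     \<lparr>carrier = {(A, b). unitary_matrix A},
      mult = (\<lambda>(A, b) (A', b'). (A ** A', A *v b' + b)),
      one = (mat 1, 0)\<rparr>"

definition act :: "(complex ^ 'n ^ 'n) \<times> (complex ^ 'n) \<Rightarrow> complex ^ 'n \<Rightarrow> complex ^ 'n" where
  "act g z = fst g *v z + snd g"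

definition autom_factor ::
    "real \<Rightarrow> real \<Rightarrow> (complex ^ 'n ^ 'n) \<times> (complex ^ 'n) \<Rightarrow> complex ^ 'n \<Rightarrow> complex" where
  "autom_factor \<nu> \<mu> g z =
     (let w = herm z (act (inv\<^bsub>motion_group\<^esub> g) 0)
      in exp (\<i> * of_real (- \<nu> * Re w + \<mu> * Im w)))"

definition T_op ::
    "real \<Rightarrow> real \<Rightarrow> (complex ^ 'n ^ 'n) \<times> (complex ^ 'n) \<Rightarrow> (complex ^ 'n \<Rightarrow> complex) \<Rightarrow>
     complex ^ 'n \<Rightarrow> complex" where
  "T_op \<nu> \<mu> g f z = autom_factor \<nu> \<mu> g z * f (act g z)"

lemma adjoint_matrix_adjoint_matrix [simp]: "adjoint_matrix (adjoint_matrix A) = A"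
  by (simp add: adjoint_matrix_def vec_eq_iff)

lemma adjoint_matrix_mult: "adjoint_matrix (A ** B) = adjoint_matrix B ** adjoint_matrix A"
  by (simp add: adjoint_matrix_def matrix_matrix_mult_def vec_eq_iff mult.commute)

lemma unitary_matrix_one: "unitary_matrix (mat 1)"
proof -
  have "adjoint_matrix (mat 1) = (mat 1 :: complex ^ 'n ^ 'n)"
    by (auto simp: adjoint_matrix_def mat_def vec_eq_iff)
  then show ?thesis by (simp add: unitary_matrix_def)
qed

lemma unitary_matrix_adjoint: "unitary_matrix A \<Longrightarrow> unitary_matrix (adjoint_matrix A)"
  by (simp add: unitary_matrix_def)

lemma unitary_matrix_mult:
  assumes A: "unitary_matrix A" and B: "unitary_matrix B"
  shows "unitary_matrix (A ** B)"
proof -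
  have "adjoint_matrix B ** adjoint_matrix A ** (A ** B)
      = adjoint_matrix B ** (adjoint_matrix A ** A) ** B"
    by (simp only: matrix_mul_assoc)
  moreover have "A ** B ** (adjoint_matrix B ** adjoint_matrix A)
      = A ** (B ** adjoint_matrix B) ** adjoint_matrix A"
    by (simp only: matrix_mul_assoc)
  ultimately show ?thesis
    using A B by (simp add: unitary_matrix_def adjoint_matrix_mult)
qed

lemma motion_inv_left:
  assumes "unitary_matrix A"
  shows "(adjoint_matrix A, - (adjoint_matrix A *v b)) \<otimes>\<^bsub>motion_group\<^esub> (A, b) = \<one>\<^bsub>motion_group\<^esub>"
  using assms by (simp add: motion_group_def unitary_matrix_def)

lemma group_motion_group: "group (motion_group :: ((complex ^ 'n ^ 'n) \<times> (complex ^ 'n)) monoid)"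
proof (rule groupI)
  fix g :: "(complex ^ 'n ^ 'n) \<times> (complex ^ 'n)"
  assume "g \<in> carrier motion_group"
  then obtain A b where g: "g = (A, b)" "unitary_matrix A"
    by (auto simp: motion_group_def)
  then show "\<exists>h\<in>carrier motion_group. h \<otimes>\<^bsub>motion_group\<^esub> g = \<one>\<^bsub>motion_group\<^esub>"
    using motion_inv_left[OF g(2)]
    by (intro bexI[of _ "(adjoint_matrix A, - (adjoint_matrix A *v b))"])
       (auto simp: motion_group_def unitary_matrix_adjoint)
qed (auto simp: motion_group_def unitary_matrix_mult unitary_matrix_one matrix_mul_assoc
        matrix_vector_mul_assoc matrix_vector_right_distrib)

lemma inv_motion_group:
  assumes "unitary_matrix A"
  shows "inv\<^bsub>motion_group\<^esub> (A, b) = (adjoint_matrix A, - (adjoint_matrix A *v b))"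
  by (rule group.inv_equality[OF group_motion_group motion_inv_left[OF assms]])
     (use assms in \<open>auto simp: motion_group_def unitary_matrix_adjoint\<close>)

lemma act_inv_0:
  assumes "unitary_matrix A"
  shows "act (inv\<^bsub>motion_group\<^esub> (A, b)) 0 = - (adjoint_matrix A *v b)"
  using assms by (simp add: inv_motion_group act_def)

end

theory Submission
  imports Defs
begin

text \<open>
  Put \<open>\<kappa> = \<nu> - i \<mu>\<close>. Up to a constant the operator is a sum of products of first-order
  operators: with the covariant Wirtinger derivatives
  \<open>L\<^sub>j = 2 \<partial>/\<partial>z\<^sub>j + i cnj \<kappa> cnj z\<^sub>j\<close> and \<open>M\<^sub>j = 2 \<partial>/\<partial>cnj z\<^sub>j + i \<kappa> z\<^sub>j\<close>,
  expanding the product gives \<open>mag_laplacian = (\<Sum>j. L\<^sub>j M\<^sub>j) - 2 \<mu> n\<close> (lemma \<open>mag_laplacian_eq_cov\<close>).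

  A motion \<open>g = (A, b)\<close> changes the magnetic potential by a constant one-form, and the phase in
  \<open>T\<close> is the gauge transformation undoing that change. Hence \<open>T\<close> only mixes the covariant
  derivatives by the linear part of the motion:
  \<open>L\<^sub>j T = T (\<Sum>k. A\<^sub>k\<^sub>j L\<^sub>k)\<close> and \<open>M\<^sub>j T = T (\<Sum>k. cnj A\<^sub>k\<^sub>j M\<^sub>k)\<close> (lemma \<open>cov_T_op\<close>).
  Consequently \<open>(\<Sum>j. L\<^sub>j M\<^sub>j) T = T (\<Sum>l k. (\<Sum>j. A\<^sub>l\<^sub>j cnj A\<^sub>k\<^sub>j) L\<^sub>l M\<^sub>k)\<close>, and the inner sum is
  the Kronecker delta because the rows of \<open>A\<close> are orthonormal.
\<close>

section \<open>Wirtinger derivatives as coefficients of the total derivative\<close>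

lemma dir_deriv_eqI:
  assumes "(f has_derivative D) (at p)"
  shows "dir_deriv v f p = D v"
proof -
  have "((\<lambda>t::real. p + t *\<^sub>R v) has_derivative (\<lambda>t. t *\<^sub>R v)) (at 0)"
    by (auto intro!: derivative_eq_intros)
  then have "((\<lambda>t::real. f (p + t *\<^sub>R v)) has_derivative (\<lambda>t. D (t *\<^sub>R v))) (at 0)"
    by (rule has_derivative_compose) (use assms in simp)
  then have "((\<lambda>t::real. f (p + t *\<^sub>R v)) has_vector_derivative D v) (at 0)"
    using has_derivative_linear[OF assms]
    by (simp add: has_vector_derivative_def linear_scale)
  then show ?thesis
    unfolding dir_deriv_def by (rule vector_derivative_at)
qed

text \<open>The real derivative splits uniquely into a complex linear and an antilinear part, and the
  Wirtinger derivatives are their coefficients. All product and chain rules below are instances: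
  the derivative is brought into this form by the rules for real derivatives, and the coefficients
  are read off.\<close>

lemma wirtinger_eqI:
  fixes f :: "complex ^ 'n \<Rightarrow> complex"
  assumes "(f has_derivative (\<lambda>v. \<Sum>k\<in>UNIV. v $ k * P k + cnj (v $ k) * Q k)) (at p)"
  shows "dz j f p = P j" and "dzbar j f p = Q j"
proof -
  have "(\<Sum>k\<in>UNIV. axis j c $ k * P k + cnj (axis j c $ k) * Q k) = c * P j + cnj c * Q j" for c
  proof -
    have "(\<Sum>k\<in>UNIV. axis j c $ k * P k + cnj (axis j c $ k) * Q k)
        = (\<Sum>k\<in>UNIV. if k = j then c * P j + cnj c * Q j else 0)"
      by (rule sum.cong) (auto simp: axis_def)
    then show ?thesis by simp
  qed
  then have "dir_deriv (axis j c) f p = c * P j + cnj c * Q j" for c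
    using dir_deriv_eqI[OF assms] by simp
  then show "dz j f p = P j" "dzbar j f p = Q j"
    by (simp_all add: dz_def dzbar_def algebra_simps)
qed

lemma has_derivative_wirtinger:
  fixes f :: "complex ^ 'n \<Rightarrow> complex"
  assumes "f differentiable (at p)"
  shows "(f has_derivative (\<lambda>v. \<Sum>k\<in>UNIV. v $ k * dz k f p + cnj (v $ k) * dzbar k f p)) (at p)"
proof -
  from assms obtain D where D: "(f has_derivative D) (at p)"
    by (auto simp: differentiable_def)
  have lin: "linear D" by (rule has_derivative_linear[OF D])
  have "D v = (\<Sum>k\<in>UNIV. v $ k * dz k f p + cnj (v $ k) * dzbar k f p)" for v
  proof -
    have "v = (\<Sum>k\<in>UNIV. Re (v $ k) *\<^sub>R axis k 1 + Im (v $ k) *\<^sub>R axis k \<i>)"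
    proof (rule vec_eq_iff[THEN iffD2, rule_format])
      fix i
      have "(\<Sum>k\<in>UNIV. Re (v $ k) *\<^sub>R axis k 1 + Im (v $ k) *\<^sub>R axis k \<i>) $ i
          = (\<Sum>k\<in>UNIV. if k = i then v $ i else 0)"
        unfolding sum_component
        by (rule sum.cong) (auto simp: axis_def complex_eq_iff)
      then show "v $ i = (\<Sum>k\<in>UNIV. Re (v $ k) *\<^sub>R axis k 1 + Im (v $ k) *\<^sub>R axis k \<i>) $ i"
        by simp
    qed
    then have "D v = D (\<Sum>k\<in>UNIV. Re (v $ k) *\<^sub>R axis k 1 + Im (v $ k) *\<^sub>R axis k \<i>)"
      by simp
    also have "\<dots> = (\<Sum>k\<in>UNIV. of_real (Re (v $ k)) * D (axis k 1) + of_real (Im (v $ k)) * D (axis k \<i>))"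
      by (simp add: linear_sum[OF lin] linear_add[OF lin] linear_scale[OF lin])
         (simp add: scaleR_conv_of_real)
    also have "\<dots> = (\<Sum>k\<in>UNIV. v $ k * dz k f p + cnj (v $ k) * dzbar k f p)"
    proof (rule sum.cong[OF refl])
      fix k
      have v: "of_real (Re (v $ k)) + \<i> * of_real (Im (v $ k)) = v $ k"
        "of_real (Re (v $ k)) - \<i> * of_real (Im (v $ k)) = cnj (v $ k)"
        by (simp_all add: complex_eq_iff)
      have "x * a + y * b
          = (x + \<i> * y) * ((a - \<i> * b) / 2) + (x - \<i> * y) * ((a + \<i> * b) / 2)"
        for x y a b :: complex
        by (simp add: field_simps)
      from this[of "of_real (Re (v $ k))" "D (axis k 1)" "of_real (Im (v $ k))" "D (axis k \<i>)"]
      show "of_real (Re (v $ k)) * D (axis k 1) + of_real (Im (v $ k)) * D (axis k \<i>)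
          = v $ k * dz k f p + cnj (v $ k) * dzbar k f p"
        unfolding dz_def dzbar_def dir_deriv_eqI[OF D] by (simp only: v)
    qed
    finally show ?thesis .
  qed
  then have "D = (\<lambda>v. \<Sum>k\<in>UNIV. v $ k * dz k f p + cnj (v $ k) * dzbar k f p)"
    by (rule ext)
  with D show ?thesis by simp
qed

lemma has_derivative_component:
  "((\<lambda>z. z $ j) has_derivative (\<lambda>v. v $ j)) (at p)" for p :: "complex ^ 'n"
  by (rule bounded_linear_imp_has_derivative) (rule bounded_linear_vec_nth)

lemma smooth_imp_differentiable:
  assumes "smooth f"
  shows "f differentiable (at p)"
  using assms Ck.simps(2)[of 0 f] unfolding smooth_def by blast

lemma smooth_imp_differentiable_dir_deriv:
  fixes f :: "complex ^ 'n \<Rightarrow> complex"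
  assumes "smooth f"
  shows "dir_deriv v f differentiable (at p)"
proof -
  have eq: "dir_deriv v f = (\<lambda>x. frechet_derivative f (at x) v)"
    by (rule ext, rule dir_deriv_eqI)
      (simp add: frechet_derivative_works[symmetric] smooth_imp_differentiable[OF assms])
  have "Ck (Suc (Suc 0)) f"
    using assms unfolding smooth_def by blast
  then show ?thesis
    unfolding eq by (simp only: Ck.simps)
qed

lemma smooth_imp_differentiable_dzbar:
  fixes f :: "complex ^ 'n \<Rightarrow> complex"
  assumes "smooth f"
  shows "dzbar j f differentiable (at p)"
proof -
  have "(\<lambda>z. (dir_deriv (axis j 1) f z + \<i> * dir_deriv (axis j \<i>) f z) * (1 / 2)) differentiable (at p)"
    by (intro differentiable_mult differentiable_add differentiable_const
        smooth_imp_differentiable_dir_deriv[OF assms])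
  moreover have "dzbar j f = (\<lambda>z. (dir_deriv (axis j 1) f z + \<i> * dir_deriv (axis j \<i>) f z) * (1 / 2))"
    by (rule ext) (simp add: dzbar_def)
  ultimately show ?thesis by simp
qed


section \<open>Covariant Wirtinger derivatives\<close>

text \<open>For the real potential \<open>a(z, v) = Re (\<kappa> * herm z v)\<close> and \<open>\<nabla>\<^sub>v = \<partial>\<^sub>v + i a(z, v)\<close>, these are
  \<open>\<nabla>\<^sub>v - i \<nabla>\<^sub>w\<close> and \<open>\<nabla>\<^sub>v + i \<nabla>\<^sub>w\<close> with \<open>v = axis j 1\<close> and \<open>w = axis j \<i>\<close>.\<close>

definition cov_dz :: "complex \<Rightarrow> 'n \<Rightarrow> (complex ^ 'n \<Rightarrow> complex) \<Rightarrow> complex ^ 'n \<Rightarrow> complex" where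
  "cov_dz \<kappa> j f z = 2 * dz j f z + \<i> * cnj \<kappa> * cnj (z $ j) * f z"

definition cov_dzbar :: "complex \<Rightarrow> 'n \<Rightarrow> (complex ^ 'n \<Rightarrow> complex) \<Rightarrow> complex ^ 'n \<Rightarrow> complex" where
  "cov_dzbar \<kappa> j f z = 2 * dzbar j f z + \<i> * \<kappa> * z $ j * f z"

lemma differentiable_component:
  "(\<lambda>z. z $ j) differentiable (at p)" for p :: "complex ^ 'n"
  using has_derivative_component differentiable_def by blast

text \<open>This is used in both directions: forwards for a smooth \<open>f\<close>, and backwards for the transformed
  function, whose covariant derivatives are known from the intertwining relation.\<close>

lemma differentiable_cov_dzbar_iff:
  fixes f :: "complex ^ 'n \<Rightarrow> complex"
  assumes "f differentiable (at p)"
  shows "cov_dzbar \<kappa> j f differentiable (at p) \<longleftrightarrow> dzbar j f differentiable (at p)"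
proof
  assume "dzbar j f differentiable (at p)"
  then have "(\<lambda>z. 2 * dzbar j f z + \<i> * \<kappa> * z $ j * f z) differentiable (at p)"
    by (intro differentiable_add differentiable_mult differentiable_const
        differentiable_component assms)
  then show "cov_dzbar \<kappa> j f differentiable (at p)"
    by (simp add: cov_dzbar_def[abs_def])
next
  assume "cov_dzbar \<kappa> j f differentiable (at p)"
  then have "(\<lambda>z. (1 / 2) * (cov_dzbar \<kappa> j f z + (- \<i> * \<kappa>) * z $ j * f z)) differentiable (at p)"
    by (intro differentiable_add differentiable_mult differentiable_const
        differentiable_component assms)
  moreover have "dzbar j f = (\<lambda>z. (1 / 2) * (cov_dzbar \<kappa> j f z + (- \<i> * \<kappa>) * z $ j * f z))"
    by (rule ext) (simp add: cov_dzbar_def)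
  ultimately show "dzbar j f differentiable (at p)" by simp
qed

lemma cov_dz_sum:
  fixes F :: "'k::finite \<Rightarrow> complex ^ 'n \<Rightarrow> complex"
  assumes "\<And>k. F k differentiable (at p)"
  shows "cov_dz \<kappa> j (\<lambda>z. \<Sum>k\<in>UNIV. c k * F k z) p = (\<Sum>k\<in>UNIV. c k * cov_dz \<kappa> j (F k) p)"
proof -
  have "((\<lambda>z. \<Sum>k\<in>UNIV. c k * F k z) has_derivative
      (\<lambda>v. \<Sum>k\<in>UNIV. c k * (\<Sum>i\<in>UNIV. v $ i * dz i (F k) p + cnj (v $ i) * dzbar i (F k) p))) (at p)"
    by (intro has_derivative_sum has_derivative_mult_right has_derivative_wirtinger assms)
  also have "(\<lambda>v. \<Sum>k\<in>UNIV. c k * (\<Sum>i\<in>UNIV. v $ i * dz i (F k) p + cnj (v $ i) * dzbar i (F k) p))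
      = (\<lambda>v. \<Sum>i\<in>UNIV. v $ i * (\<Sum>k\<in>UNIV. c k * dz i (F k) p)
                    + cnj (v $ i) * (\<Sum>k\<in>UNIV. c k * dzbar i (F k) p))"
    apply (rule ext)
    apply (simp add: sum_distrib_left sum.distrib[symmetric])
    apply (subst sum.swap)
    apply (simp add: algebra_simps)
    done
  finally have "dz j (\<lambda>z. \<Sum>k\<in>UNIV. c k * F k z) p = (\<Sum>k\<in>UNIV. c k * dz j (F k) p)"
    by (rule wirtinger_eqI)
  then show ?thesis
    by (simp add: cov_dz_def sum_distrib_left sum.distrib algebra_simps)
qed

lemma dz_cov_dzbar:
  fixes f :: "complex ^ 'n \<Rightarrow> complex"
  assumes f: "f differentiable (at p)" and "dzbar j f differentiable (at p)"
  shows "dz j (cov_dzbar \<kappa> j f) p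
       = 2 * dz j (dzbar j f) p + \<i> * \<kappa> * (f p + p $ j * dz j f p)"
proof -
  let ?P = "\<lambda>k. 2 * dz k (dzbar j f) p + \<i> * \<kappa> * ((if k = j then f p else 0) + p $ j * dz k f p)"
  let ?Q = "\<lambda>k. 2 * dzbar k (dzbar j f) p + \<i> * \<kappa> * (p $ j * dzbar k f p)"
  have "(cov_dzbar \<kappa> j f has_derivative (\<lambda>v.
       2 * (\<Sum>k\<in>UNIV. v $ k * dz k (dzbar j f) p + cnj (v $ k) * dzbar k (dzbar j f) p)
     + \<i> * \<kappa> * (p $ j * (\<Sum>k\<in>UNIV. v $ k * dz k f p + cnj (v $ k) * dzbar k f p) + v $ j * f p))) (at p)"
    unfolding cov_dzbar_def[abs_def] mult.assoc[of "\<i> * \<kappa>"]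
    by (intro has_derivative_add has_derivative_mult_right has_derivative_mult
        has_derivative_component has_derivative_wirtinger assms)
  also have "(\<lambda>v. 2 * (\<Sum>k\<in>UNIV. v $ k * dz k (dzbar j f) p + cnj (v $ k) * dzbar k (dzbar j f) p)
     + \<i> * \<kappa> * (p $ j * (\<Sum>k\<in>UNIV. v $ k * dz k f p + cnj (v $ k) * dzbar k f p) + v $ j * f p))
     = (\<lambda>v. \<Sum>k\<in>UNIV. v $ k * ?P k + cnj (v $ k) * ?Q k)"
  proof
    fix v :: "complex ^ 'n"
    have "v $ j * f p = (\<Sum>k\<in>UNIV. v $ k * (if k = j then f p else 0))"
      by (simp add: if_distrib[of "\<lambda>x. _ * x"] cong: if_cong)
    then show "2 * (\<Sum>k\<in>UNIV. v $ k * dz k (dzbar j f) p + cnj (v $ k) * dzbar k (dzbar j f) p)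
     + \<i> * \<kappa> * (p $ j * (\<Sum>k\<in>UNIV. v $ k * dz k f p + cnj (v $ k) * dzbar k f p) + v $ j * f p)
     = (\<Sum>k\<in>UNIV. v $ k * ?P k + cnj (v $ k) * ?Q k)"
      by (simp only: sum_distrib_left sum.distrib[symmetric]) (simp only: algebra_simps)
  qed
  finally have "dz j (cov_dzbar \<kappa> j f) p = ?P j"
    by (rule wirtinger_eqI(1))
  then show ?thesis by simp
qed

text \<open>The first-order terms of \<open>mag_laplacian\<close> are \<open>2 i \<kappa> euler + 2 i cnj \<kappa> euler_bar\<close>, which is what the
  cross terms of the products contribute. Differentiating the factor \<open>z\<^sub>j\<close> adds the constant
  \<open>2 i \<kappa> n = 2 i \<nu> n + 2 \<mu> n\<close>, so \<open>2 \<mu> n\<close> is left over.\<close>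

lemma mag_laplacian_eq_cov:
  fixes f :: "complex ^ 'n \<Rightarrow> complex"
  assumes "f differentiable (at p)" and "\<And>j. dzbar j f differentiable (at p)"
    and \<kappa>: "\<kappa> = Complex \<nu> (- \<mu>)"
  shows "mag_laplacian \<nu> \<mu> f p
       = (\<Sum>j\<in>UNIV. cov_dz \<kappa> j (cov_dzbar \<kappa> j f) p) - 2 * of_real \<mu> * of_nat CARD('n) * f p"
proof -
  have k: "\<i> * \<kappa> = \<i> * of_real \<nu> + of_real \<mu>" "\<i> * cnj \<kappa> = \<i> * of_real \<nu> - of_real \<mu>"
    by (simp_all add: \<kappa> complex_eq_iff)
  have kk: "\<kappa> * cnj \<kappa> = of_real (\<nu>\<^sup>2 + \<mu>\<^sup>2)"
    by (simp add: \<kappa> complex_eq_iff power2_eq_square)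
  have nrm: "of_real ((norm p)\<^sup>2) = (\<Sum>j\<in>UNIV. p $ j * cnj (p $ j))"
    by (simp add: norm_vec_def L2_set_def sum_nonneg complex_norm_square[symmetric])
  have summand: "cov_dz \<kappa> j (cov_dzbar \<kappa> j f) p
      = 4 * dz j (dzbar j f) p + 2 * (\<i> * \<kappa>) * f p + 2 * (\<i> * \<kappa>) * (p $ j * dz j f p)
        + 2 * (\<i> * cnj \<kappa>) * (cnj (p $ j) * dzbar j f p)
        - \<kappa> * cnj \<kappa> * f p * (p $ j * cnj (p $ j))" for j
  proof -
    have "cov_dz \<kappa> j (cov_dzbar \<kappa> j f) p
      = 2 * (2 * dz j (dzbar j f) p + \<i> * \<kappa> * (f p + p $ j * dz j f p))
        + \<i> * cnj \<kappa> * cnj (p $ j) * (2 * dzbar j f p + \<i> * \<kappa> * p $ j * f p)"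
      by (simp add: cov_dz_def dz_cov_dzbar assms) (simp add: cov_dzbar_def)
    also have "\<dots> = 4 * dz j (dzbar j f) p + 2 * (\<i> * \<kappa>) * f p + 2 * (\<i> * \<kappa>) * (p $ j * dz j f p)
        + 2 * (\<i> * cnj \<kappa>) * (cnj (p $ j) * dzbar j f p)
        + (\<i> * \<i>) * (\<kappa> * cnj \<kappa> * f p * (p $ j * cnj (p $ j)))"
      by (simp only: algebra_simps) simp
    finally show ?thesis by simp
  qed
  have "(\<Sum>j\<in>UNIV. cov_dz \<kappa> j (cov_dzbar \<kappa> j f) p)
      = 4 * (\<Sum>j\<in>UNIV. dz j (dzbar j f) p) + of_nat CARD('n) * (2 * (\<i> * \<kappa>) * f p)
        + 2 * (\<i> * \<kappa>) * euler f p + 2 * (\<i> * cnj \<kappa>) * euler_bar f p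
        - of_real (\<nu>\<^sup>2 + \<mu>\<^sup>2) * f p * of_real ((norm p)\<^sup>2)"
    unfolding summand euler_def euler_bar_def nrm kk
    by (simp only: sum.distrib sum_subtractf sum_distrib_left sum_constant)
  then show ?thesis
    unfolding mag_laplacian_def k by (simp add: algebra_simps)
qed


section \<open>Intertwining with the motion group\<close>

lemma unitary_matrix_columns:
  assumes "unitary_matrix A"
  shows "(\<Sum>k\<in>UNIV. A $ k $ i * cnj (A $ k $ j)) = (if i = j then 1 else 0)"
proof -
  have "(adjoint_matrix A ** A) $ j $ i = mat 1 $ j $ i"
    using assms by (simp add: unitary_matrix_def)
  then show ?thesis
    by (auto simp: matrix_matrix_mult_def adjoint_matrix_def mat_def mult.commute)
qed

lemma unitary_matrix_rows:
  assumes "unitary_matrix A"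
  shows "(\<Sum>j\<in>UNIV. A $ k $ j * cnj (A $ l $ j)) = (if k = l then 1 else 0)"
proof -
  have "(A ** adjoint_matrix A) $ k $ l = mat 1 $ k $ l"
    using assms by (simp add: unitary_matrix_def)
  then show ?thesis
    by (auto simp: matrix_matrix_mult_def adjoint_matrix_def mat_def)
qed

lemma unitary_matrix_adjoint_apply:
  assumes "unitary_matrix A"
  shows "(\<Sum>k\<in>UNIV. A $ k $ j * cnj ((A *v z) $ k)) = cnj (z $ j)"
proof -
  have "(\<Sum>k\<in>UNIV. A $ k $ j * cnj ((A *v z) $ k))
      = (\<Sum>k\<in>UNIV. \<Sum>i\<in>UNIV. cnj (z $ i) * (A $ k $ j * cnj (A $ k $ i)))"
    by (simp add: matrix_vector_mult_def sum_distrib_left algebra_simps)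
  also have "\<dots> = (\<Sum>i\<in>UNIV. cnj (z $ i) * (\<Sum>k\<in>UNIV. A $ k $ j * cnj (A $ k $ i)))"
    by (subst sum.swap) (simp add: sum_distrib_left)
  finally show ?thesis
    by (simp add: unitary_matrix_columns[OF assms] if_distrib[of "\<lambda>x. _ * x"] cong: if_cong)
qed

text \<open>Writing the real phase as half the sum of a number and its conjugate separates the parts of
  its derivative that are complex linear and antilinear in \<open>z\<close>.\<close>

lemma autom_factor_eq:
  assumes A: "unitary_matrix A" and \<kappa>: "\<kappa> = Complex \<nu> (- \<mu>)"
  shows "autom_factor \<nu> \<mu> (A, b) z
       = exp (\<i> / 2 * (cnj \<kappa> * herm (A *v z) b + \<kappa> * herm b (A *v z)))"
proof -
  have "herm z (adjoint_matrix A *v b) = (\<Sum>j\<in>UNIV. \<Sum>k\<in>UNIV. z $ j * (A $ k $ j * cnj (b $ k)))"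
    by (simp add: herm_def matrix_vector_mult_def adjoint_matrix_def sum_distrib_left)
  also have "\<dots> = herm (A *v z) b"
    by (subst sum.swap)
       (simp add: herm_def matrix_vector_mult_def sum_distrib_left sum_distrib_right mult_ac)
  finally have "herm z (- (adjoint_matrix A *v b)) = - herm (A *v z) b"
    by (simp add: herm_def sum_negf)
  then have "autom_factor \<nu> \<mu> (A, b) z
      = exp (\<i> * of_real (\<nu> * Re (herm (A *v z) b) - \<mu> * Im (herm (A *v z) b)))"
    by (simp add: autom_factor_def act_inv_0[OF A])
  moreover have "herm b (A *v z) = cnj (herm (A *v z) b)"
    by (simp add: herm_def mult.commute)
  moreover have "\<i> * of_real (\<nu> * Re w - \<mu> * Im w) = \<i> / 2 * (cnj \<kappa> * w + \<kappa> * cnj w)" for w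
    by (simp add: \<kappa> complex_eq_iff)
  ultimately show ?thesis by (simp only:)
qed

lemma has_derivative_T_op:
  fixes f :: "complex ^ 'n \<Rightarrow> complex"
  assumes A: "unitary_matrix A" and \<kappa>: "\<kappa> = Complex \<nu> (- \<mu>)"
    and f: "f differentiable (at (act (A, b) z))"
  shows "(T_op \<nu> \<mu> (A, b) f has_derivative (\<lambda>v. \<Sum>j\<in>UNIV.
      v $ j * (autom_factor \<nu> \<mu> (A, b) z * (\<Sum>k\<in>UNIV. A $ k $ j *
          (dz k f (act (A, b) z) + \<i> / 2 * cnj \<kappa> * cnj (b $ k) * f (act (A, b) z))))
    + cnj (v $ j) * (autom_factor \<nu> \<mu> (A, b) z * (\<Sum>k\<in>UNIV. cnj (A $ k $ j) *
          (dzbar k f (act (A, b) z) + \<i> / 2 * \<kappa> * b $ k * f (act (A, b) z)))))) (at z)"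
proof -
  let ?w = "act (A, b) z" and ?J = "autom_factor \<nu> \<mu> (A, b)"
  have lin: "((\<lambda>z. A *v z) has_derivative (\<lambda>v. A *v v)) (at z)"
    by (rule bounded_linear_imp_has_derivative)
       (simp add: linear_conv_bounded_linear[symmetric] linear_iff matrix_vector_right_distrib
          scaleR_vec_def matrix_vector_mult_def vec_eq_iff scaleR_sum_right
          distrib_left sum.distrib)
  have comp: "((\<lambda>z. (A *v z) $ k) has_derivative (\<lambda>v. (A *v v) $ k)) (at z)" for k
    using has_derivative_compose[OF lin has_derivative_component] .
  have J: "(?J has_derivative (\<lambda>v. ?J z * (\<i> / 2 *
      (cnj \<kappa> * herm (A *v v) b + \<kappa> * herm b (A *v v))))) (at z)"
    unfolding autom_factor_eq[OF A \<kappa>, abs_def]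
  proof (rule has_derivative_compose[OF _ DERIV_exp[unfolded has_field_derivative_def]])
    show "((\<lambda>z. \<i> / 2 * (cnj \<kappa> * herm (A *v z) b + \<kappa> * herm b (A *v z))) has_derivative
        (\<lambda>v. \<i> / 2 * (cnj \<kappa> * herm (A *v v) b + \<kappa> * herm b (A *v v)))) (at z)"
      unfolding herm_def
      by (intro has_derivative_mult_right has_derivative_add has_derivative_sum
          has_derivative_mult_left has_derivative_cnj comp)
  qed
  have "((\<lambda>z. act (A, b) z) has_derivative (\<lambda>v. A *v v)) (at z)"
    using has_derivative_add[OF lin has_derivative_const[of b]] by (simp add: act_def)
  from has_derivative_compose[OF this has_derivative_wirtinger[OF f]]
  have F: "((\<lambda>z. f (act (A, b) z)) has_derivative (\<lambda>v.
      \<Sum>k\<in>UNIV. (A *v v) $ k * dz k f ?w + cnj ((A *v v) $ k) * dzbar k f ?w)) (at z)" .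
  have "(?J z * (\<Sum>k\<in>UNIV. (A *v v) $ k * dz k f ?w + cnj ((A *v v) $ k) * dzbar k f ?w)
      + ?J z * (\<i> / 2 * (cnj \<kappa> * herm (A *v v) b + \<kappa> * herm b (A *v v))) * f ?w)
    = (\<Sum>j\<in>UNIV. v $ j * (?J z * (\<Sum>k\<in>UNIV. A $ k $ j *
          (dz k f ?w + \<i> / 2 * cnj \<kappa> * cnj (b $ k) * f ?w)))
    + cnj (v $ j) * (?J z * (\<Sum>k\<in>UNIV. cnj (A $ k $ j) *
          (dzbar k f ?w + \<i> / 2 * \<kappa> * b $ k * f ?w))))" (is "?lhs = ?rhs") for v
  proof -
    let ?p = "\<lambda>k. dz k f ?w + \<i> / 2 * cnj \<kappa> * cnj (b $ k) * f ?w"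
    let ?q = "\<lambda>k. dzbar k f ?w + \<i> / 2 * \<kappa> * b $ k * f ?w"
    have "?lhs = ?J z * (\<Sum>k\<in>UNIV. (A *v v) $ k * ?p k + cnj ((A *v v) $ k) * ?q k)"
      unfolding herm_def
      by (simp only: sum_distrib_left sum_distrib_right sum.distrib[symmetric])
         (simp only: algebra_simps)
    also have "\<dots> = (\<Sum>k\<in>UNIV. \<Sum>j\<in>UNIV.
        v $ j * (?J z * (A $ k $ j * ?p k)) + cnj (v $ j) * (?J z * (cnj (A $ k $ j) * ?q k)))"
      by (simp only: matrix_vector_mult_def vec_lambda_beta cnj_sum complex_cnj_mult
            sum_distrib_left sum_distrib_right sum.distrib[symmetric])
         (simp only: algebra_simps)
    also have "\<dots> = ?rhs"
      by (subst sum.swap) (simp only: sum_distrib_left sum.distrib[symmetric])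
    finally show ?thesis .
  qed
  with has_derivative_mult[OF J F] show ?thesis
    by (simp add: T_op_def[abs_def])
qed

text \<open>By the chain rule the plain derivatives transform by \<open>A\<close>, and the phase adds twice
  \<open>(i / 2) cnj \<kappa> cnj b\<^sub>k\<close>, respectively \<open>(i / 2) \<kappa> b\<^sub>k\<close>: exactly the difference of the potentials at
  \<open>A z + b\<close> and at \<open>A z\<close>. The potential at \<open>A z\<close>, pulled back by \<open>A\<close>, is the one at \<open>z\<close> since \<open>A\<close>
  is unitary.\<close>

lemma cov_T_op:
  fixes f :: "complex ^ 'n \<Rightarrow> complex"
  assumes A: "unitary_matrix A" and \<kappa>: "\<kappa> = Complex \<nu> (- \<mu>)"
    and f: "f differentiable (at (act (A, b) z))"
  shows "cov_dz \<kappa> j (T_op \<nu> \<mu> (A, b) f) z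
       = T_op \<nu> \<mu> (A, b) (\<lambda>w. \<Sum>k\<in>UNIV. A $ k $ j * cov_dz \<kappa> k f w) z"
    and "cov_dzbar \<kappa> j (T_op \<nu> \<mu> (A, b) f) z
       = T_op \<nu> \<mu> (A, b) (\<lambda>w. \<Sum>k\<in>UNIV. cnj (A $ k $ j) * cov_dzbar \<kappa> k f w) z"
proof -
  let ?w = "act (A, b) z" and ?J = "autom_factor \<nu> \<mu> (A, b) z"
  note D = wirtinger_eqI[OF has_derivative_T_op[OF A \<kappa> f]]
  have w: "?w $ k = (A *v z) $ k + b $ k" for k
    by (simp add: act_def)
  have z: "cnj (z $ j) = (\<Sum>k\<in>UNIV. A $ k $ j * cnj ((A *v z) $ k))"
    by (rule unitary_matrix_adjoint_apply[OF A, symmetric])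
  then have zbar: "z $ j = (\<Sum>k\<in>UNIV. cnj (A $ k $ j) * (A *v z) $ k)"
    by (metis (no_types, lifting) cnj_sum complex_cnj_cnj complex_cnj_mult sum.cong)
  show "cov_dz \<kappa> j (T_op \<nu> \<mu> (A, b) f) z
       = T_op \<nu> \<mu> (A, b) (\<lambda>w. \<Sum>k\<in>UNIV. A $ k $ j * cov_dz \<kappa> k f w) z"
    unfolding cov_dz_def D z T_op_def w sum_distrib_left sum_distrib_right sum.distrib[symmetric]
    by (rule sum.cong) (simp_all add: field_simps)
  show "cov_dzbar \<kappa> j (T_op \<nu> \<mu> (A, b) f) z
       = T_op \<nu> \<mu> (A, b) (\<lambda>w. \<Sum>k\<in>UNIV. cnj (A $ k $ j) * cov_dzbar \<kappa> k f w) z"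
    unfolding cov_dzbar_def D T_op_def w
    apply (subst zbar)
    unfolding sum_distrib_left sum_distrib_right sum.distrib[symmetric]
    by (rule sum.cong) (simp_all add: field_simps)
qed

theorem proposition4p3:
  fixes \<nu> \<mu> :: real
    and g :: "(complex ^ 'n ^ 'n) \<times> (complex ^ 'n)"
    and f :: "complex ^ 'n \<Rightarrow> complex"
  assumes "\<mu> > 0"
    and "g \<in> carrier motion_group"
    and "smooth f"
  shows "mag_laplacian \<nu> \<mu> (T_op \<nu> \<mu> g f) = T_op \<nu> \<mu> g (mag_laplacian \<nu> \<mu> f)"
proof
  fix z :: "complex ^ 'n"
  from assms(2) obtain A b where g: "g = (A, b)" and A: "unitary_matrix A"
    by (auto simp: motion_group_def)
  define \<kappa> where \<kappa>: "\<kappa> = Complex \<nu> (- \<mu>)"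
  let ?T = "T_op \<nu> \<mu> (A, b)" and ?w = "act (A, b) z"
  note f = smooth_imp_differentiable[OF \<open>smooth f\<close>]
  note fbar = smooth_imp_differentiable_dzbar[OF \<open>smooth f\<close>]
  have M: "cov_dzbar \<kappa> k f differentiable (at p)" for k p
    by (simp add: differentiable_cov_dzbar_iff f fbar)
  define G where "G j = (\<lambda>w. \<Sum>k\<in>UNIV. cnj (A $ k $ j) * cov_dzbar \<kappa> k f w)" for j
  have G: "G j differentiable (at p)" for j p
    unfolding G_def by (intro differentiable_sum differentiable_mult differentiable_const M ballI) simp
  have T: "?T h differentiable (at p)" if "\<And>p. h differentiable (at p)" for h p
    using has_derivative_T_op[OF A \<kappa> that] unfolding differentiable_def by blast
  have MT: "cov_dzbar \<kappa> j (?T f) = ?T (G j)" for j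
    unfolding G_def by (rule ext) (rule cov_T_op(2)[OF A \<kappa> f])
  \<comment> \<open>the second derivatives of the transformed function exist by the intertwining relation itself\<close>
  have Tbar: "dzbar j (?T f) differentiable (at p)" for j p
    using T[OF G] differentiable_cov_dzbar_iff[OF T[OF f], of \<kappa> j] by (simp add: MT)
  have "(\<Sum>j\<in>UNIV. cov_dz \<kappa> j (cov_dzbar \<kappa> j (?T f)) z)
      = (\<Sum>j\<in>UNIV. ?T (\<lambda>w. \<Sum>l\<in>UNIV. A $ l $ j * cov_dz \<kappa> l (G j) w) z)"
    by (simp only: MT cov_T_op(1)[OF A \<kappa> G])
  also have "\<dots> = autom_factor \<nu> \<mu> (A, b) z * (\<Sum>j\<in>UNIV. \<Sum>l\<in>UNIV. \<Sum>k\<in>UNIV.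
      A $ l $ j * cnj (A $ k $ j) * cov_dz \<kappa> l (cov_dzbar \<kappa> k f) ?w)"
    by (simp only: T_op_def G_def cov_dz_sum[OF M] sum_distrib_left mult.assoc)
  also have "(\<Sum>j\<in>UNIV. \<Sum>l\<in>UNIV. \<Sum>k\<in>UNIV.
        A $ l $ j * cnj (A $ k $ j) * cov_dz \<kappa> l (cov_dzbar \<kappa> k f) ?w)
      = (\<Sum>l\<in>UNIV. \<Sum>k\<in>UNIV. \<Sum>j\<in>UNIV.
        A $ l $ j * cnj (A $ k $ j) * cov_dz \<kappa> l (cov_dzbar \<kappa> k f) ?w)"
    by (subst sum.swap, rule sum.cong[OF refl], rule sum.swap)
  also have "\<dots> = (\<Sum>l\<in>UNIV. \<Sum>k\<in>UNIV.
        (if l = k then 1 else 0) * cov_dz \<kappa> l (cov_dzbar \<kappa> k f) ?w)"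
    by (simp only: sum_distrib_right[symmetric] unitary_matrix_rows[OF A])
  also have "\<dots> = (\<Sum>l\<in>UNIV. cov_dz \<kappa> l (cov_dzbar \<kappa> l f) ?w)"
    by (simp add: if_distrib[of "\<lambda>x. x * _"] cong: if_cong)
  finally show "mag_laplacian \<nu> \<mu> (T_op \<nu> \<mu> g f) z = T_op \<nu> \<mu> g (mag_laplacian \<nu> \<mu> f) z"
    unfolding g mag_laplacian_eq_cov[OF T[OF f] Tbar \<kappa>]
    by (simp add: T_op_def[of _ _ _ _ z] mag_laplacian_eq_cov[OF f fbar \<kappa>] right_diff_distrib)
qed

end
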